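(* Let $r\in(2,3)$ and let $c_r>0$ be the constant (depending only on $r$) used in the definition of the determining wavenumber $\Lambda_{u,r}$. There exists a constant $C_r>0$, depending only on $r$ (and the choice of $c_r$), such that for every $L>0$, $\nu>0$, every weak solution $u$ of the 3D Navier-Stokes equations on $\mathbb{T}^3=[0,L]^3$ with viscosity $\nu$ and zero-mean force, and every time $t$, $$\Lambda_{u,r}(t)-\lambda_0\le C_r\,\frac{\|\nabla u(t)\|_{L^2}^2}{\nu^2},$$ where $\lambda_0=1/L$ and the right-hand side is $+\infty$ if $\nabla u(t)\notin L^2$.
   Context: Equations: on the torus $\mathbb{T}^3=[0,L]^3$ (periodic), $u_t+(u\cdot\nabla)u-\nu\Delta u+\nabla p=f$, $\nabla\cdot u=0$, with $\nu>0$, $f\in H^{-1}(\mathbb{T}^3)$ a time-independent force of zero mean; all solutions are of zero mean. Weak solution on $[0,T]$: a function $u\in C_{\mathrm w}([0,T];L^2(\mathbb{T}^3))\cap L^2_{\rm loc}([0,T];H^1(\mathbb{T}^3))$, with $\nabla\cdot u=0$ in the sense of distributions, such that $$(u(t),\varphi(t))+\int_0^t\big[-(u,\partial_t\varphi)+\nu(\nabla u,\nabla\varphi)+(u\cdot\nabla u,\varphi)-(f,\varphi)\big]\,ds=(u(0),\varphi(0))$$ for all $t\in[0,T]$ and all $\varphi\in C^\infty([0,T]\times\mathbb{T}^3)$ with $\nabla\cdot\varphi=0$. Littlewood-Paley projections: $\lambda_q:=2^q/L$ for integers $q$. Fix once and for all a nonnegative radial $\chi\in C_0^\infty(\mathbb{R}^3)$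 with $\chi(\xi)=1$ for $|\xi|\le 3/4$ and $\chi(\xi)=0$ for $|\xi|\ge1$ (constants may depend on this fixed $\chi$). Let $\varphi(\xi)=\chi(\xi/2)-\chi(\xi)$, $\varphi_q(\xi)=\varphi(2^{-q}\xi)$ for $q\ge0$, $\varphi_{-1}=\chi$. For $q\ge-1$, $u_q:=\Delta_q u:=\sum_{k\in\mathbb{Z}^3}\widehat u(k)\varphi_q(k)e^{i\frac{2\pi}{L}k\cdot x}$, where $\widehat u(k)$ is the $k$th Fourier coefficient, and $u_{\le q}:=\sum_{p=-1}^q u_p$. Determining wavenumber: for $r\in(2,3)$ and a constant $c_r>0$, $$\Lambda_{u,r}(t):=\min\{\lambda_q:\ q\in\mathbb{N},\ \lambda_p^{-1+\frac3r}\|u_p(t)\|_{L^r}<c_r\nu\ \ \forall p>q,\ \text{ and }\ \lambda_q^{-1}\|u_{\le q}(t)\|_{L^\infty}<c_r\nu\},$$ where $\mathbb{N}=\{0,1,2,\dots\}$ and $\min\emptyset=\infty$. *)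

theory Defs
  imports "HOL-Analysis.Analysis" "HOL-Probability.Essential_Supremum"
begin

section \<open>Smooth functions\<close>

text \<open>
  Derivatives are taken within \<^term>\<open>S\<close>. For convex \<^term>\<open>S\<close> with nonempty interior they are
  unique, so that on \<^term>\<open>{0..T} \<times> UNIV\<close> this is smoothness up to the boundary, with one-sided
  time derivatives at \<^term>\<open>0\<close> and \<^term>\<open>T\<close>.
\<close>

primrec Ck_on :: "nat \<Rightarrow> 'a::real_normed_vector set \<Rightarrow> ('a \<Rightarrow> 'b::real_normed_vector) \<Rightarrow> bool" where
  "Ck_on 0 S f \<longleftrightarrow> continuous_on S f"
| "Ck_on (Suc n) S f \<longleftrightarrow>
     f differentiable_on S \<and> (\<forall>v. Ck_on n S (\<lambda>x. frechet_derivative f (at x within S) v))"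

definition smooth_on :: "'a::real_normed_vector set \<Rightarrow> ('a \<Rightarrow> 'b::real_normed_vector) \<Rightarrow> bool" where
  "smooth_on S f \<longleftrightarrow> (\<forall>n. Ck_on n S f)"


section \<open>Function spaces on the torus\<close>

text \<open>
  Measurable functions on the torus of side \<^term>\<open>L\<close> are functions on \<^typ>\<open>real^3\<close> of which only the
  values in the box \<open>[0,L]\<^sup>3\<close> matter. The torus structure enters through the periodicity of the
  test functions. The measure is not normalised.
\<close>

definition torus :: "real \<Rightarrow> (real^3) measure" where
  "torus L = lebesgue_on (cbox 0 (vec L))"

definition periodic :: "real \<Rightarrow> (real^3 \<Rightarrow> 'b) \<Rightarrow> bool" where
  "periodic L g \<longleftrightarrow> (\<forall>x i. g (x + L *\<^sub>R axis i 1) = g x)"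

definition zero_mean :: "real \<Rightarrow> (real^3 \<Rightarrow> real^3) \<Rightarrow> bool" where
  "zero_mean L v \<longleftrightarrow> (LINT x|torus L. v x) = 0"

definition in_L2 :: "real \<Rightarrow> (real^3 \<Rightarrow> 'b::euclidean_space) \<Rightarrow> bool" where
  "in_L2 L v \<longleftrightarrow> v \<in> borel_measurable (torus L) \<and> integrable (torus L) (\<lambda>x. (norm (v x))\<^sup>2)"

definition partial :: "3 \<Rightarrow> (real^3 \<Rightarrow> real) \<Rightarrow> real^3 \<Rightarrow> real" where
  "partial j \<psi> x = frechet_derivative \<psi> (at x) (axis j 1)"

text \<open>\<open>G $ i $ j\<close> is the derivative of the \<open>i\<close>-th component in the direction \<open>j\<close>, as in
  \<^const>\<open>jacobian\<close>.\<close>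

definition is_weak_grad :: "real \<Rightarrow> (real^3 \<Rightarrow> real^3) \<Rightarrow> (real^3 \<Rightarrow> real^3^3) \<Rightarrow> bool" where
  "is_weak_grad L v G \<longleftrightarrow> in_L2 L G \<and>
     (\<forall>\<psi>. smooth_on UNIV \<psi> \<and> periodic L \<psi> \<longrightarrow>
        (\<forall>i j. (LINT x|torus L. v x $ i * partial j \<psi> x) = - (LINT x|torus L. G x $ i $ j * \<psi> x)))"

definition weak_grad :: "real \<Rightarrow> (real^3 \<Rightarrow> real^3) \<Rightarrow> real^3 \<Rightarrow> real^3^3" where
  "weak_grad L v = (SOME G. is_weak_grad L v G)"

definition grad_norm_sq :: "real \<Rightarrow> (real^3 \<Rightarrow> real^3) \<Rightarrow> ennreal" where
  "grad_norm_sq L v =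
     (if \<exists>G. is_weak_grad L v G then \<integral>\<^sup>+x. ennreal ((norm (weak_grad L v x))\<^sup>2) \<partial>torus L else \<infinity>)"

definition in_H1 :: "real \<Rightarrow> (real^3 \<Rightarrow> real^3) \<Rightarrow> bool" where
  "in_H1 L v \<longleftrightarrow> in_L2 L v \<and> (\<exists>G. is_weak_grad L v G)"

definition H1_norm_sq :: "real \<Rightarrow> (real^3 \<Rightarrow> real^3) \<Rightarrow> ennreal" where
  "H1_norm_sq L v = (\<integral>\<^sup>+x. ennreal ((norm (v x))\<^sup>2) \<partial>torus L) + grad_norm_sq L v"

definition weakly_div_free :: "real \<Rightarrow> (real^3 \<Rightarrow> real^3) \<Rightarrow> bool" where
  "weakly_div_free L v \<longleftrightarrow>
     (\<forall>\<psi>. smooth_on UNIV \<psi> \<and> periodic L \<psi> \<longrightarrow>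
        (LINT x|torus L. (\<Sum>i\<in>UNIV. v x $ i * partial i \<psi> x)) = 0)"

text \<open>An element of \<open>H\<^sup>-\<^sup>1\<close> is a bounded linear functional on \<open>H\<^sup>1\<close>; the value of \<^term>\<open>f\<close>
  at fields outside \<open>H\<^sup>1\<close> is irrelevant.\<close>

definition in_Hminus1 :: "real \<Rightarrow> ((real^3 \<Rightarrow> real^3) \<Rightarrow> real) \<Rightarrow> bool" where
  "in_Hminus1 L f \<longleftrightarrow>
     (\<forall>v w. in_H1 L v \<and> in_H1 L w \<longrightarrow> f (\<lambda>x. v x + w x) = f v + f w) \<and>
     (\<forall>a v. in_H1 L v \<longrightarrow> f (\<lambda>x. a *\<^sub>R v x) = a * f v) \<and>
     (\<exists>K. \<forall>v. in_H1 L v \<longrightarrow> \<bar>f v\<bar> \<le> K * sqrt (enn2real (H1_norm_sq L v)))"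

definition zero_mean_force :: "((real^3 \<Rightarrow> real^3) \<Rightarrow> real) \<Rightarrow> bool" where
  "zero_mean_force f \<longleftrightarrow> (\<forall>a. f (\<lambda>x. a) = 0)"


section \<open>Weak solutions of the Navier-Stokes equations\<close>

definition weakly_continuous :: "real \<Rightarrow> real \<Rightarrow> (real \<Rightarrow> real^3 \<Rightarrow> real^3) \<Rightarrow> bool" where
  "weakly_continuous L T u \<longleftrightarrow>
     (\<forall>t\<in>{0..T}. in_L2 L (u t)) \<and>
     (\<forall>g. in_L2 L g \<longrightarrow> continuous_on {0..T} (\<lambda>t. LINT x|torus L. u t x \<bullet> g x))"

text \<open>Square integrability in time with values in \<open>H\<^sup>1\<close>, for weakly continuous \<^term>\<open>u\<close>. The
  \<open>H\<^sup>1\<close> norm is then lower semicontinuous in time, and strong measurability in time is automatic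
  by Pettis' theorem, so no measurability condition is imposed.\<close>

definition L2_in_time_H1 :: "real \<Rightarrow> real \<Rightarrow> (real \<Rightarrow> real^3 \<Rightarrow> real^3) \<Rightarrow> bool" where
  "L2_in_time_H1 L T u \<longleftrightarrow>
     (AE t in lebesgue_on {0..T}. in_H1 L (u t)) \<and>
     (\<integral>\<^sup>+t. H1_norm_sq L (u t) \<partial>lebesgue_on {0..T}) < \<infinity>"

definition test_field :: "real \<Rightarrow> real \<Rightarrow> (real \<Rightarrow> real^3 \<Rightarrow> real^3) \<Rightarrow> bool" where
  "test_field L T \<phi> \<longleftrightarrow>
     smooth_on ({0..T} \<times> UNIV) (\<lambda>(t, x). \<phi> t x) \<and>
     (\<forall>t\<in>{0..T}. periodic L (\<phi> t)) \<and>
     (\<forall>t\<in>{0..T}. \<forall>x. trace (jacobian (\<phi> t) (at x)) = 0)"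

definition time_deriv :: "real \<Rightarrow> (real \<Rightarrow> real^3 \<Rightarrow> real^3) \<Rightarrow> real \<Rightarrow> real^3 \<Rightarrow> real^3" where
  "time_deriv T \<phi> s x = vector_derivative (\<lambda>\<tau>. \<phi> \<tau> x) (at s within {0..T})"

text \<open>With \<open>G = \<nabla>v\<close>, the field \<open>(v \<cdot> \<nabla>)v\<close> is \<open>G *v v\<close>.\<close>

definition weak_solution ::
  "real \<Rightarrow> real \<Rightarrow> ((real^3 \<Rightarrow> real^3) \<Rightarrow> real) \<Rightarrow> real \<Rightarrow> (real \<Rightarrow> real^3 \<Rightarrow> real^3) \<Rightarrow> bool" where
  "weak_solution L \<nu> f T u \<longleftrightarrow>
     weakly_continuous L T u \<and>
     L2_in_time_H1 L T u \<and>
     (\<forall>t\<in>{0..T}. weakly_div_free L (u t)) \<and>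
     (\<forall>t\<in>{0..T}. \<forall>\<phi>. test_field L T \<phi> \<longrightarrow>
        (LINT x|torus L. u t x \<bullet> \<phi> t x) +
        (LINT s|lebesgue_on {0..t}.
           - (LINT x|torus L. u s x \<bullet> time_deriv T \<phi> s x)
           + \<nu> * (LINT x|torus L. weak_grad L (u s) x \<bullet> jacobian (\<phi> s) (at x))
           + (LINT x|torus L. (weak_grad L (u s) x *v u s x) \<bullet> \<phi> s x)
           - f (\<phi> s))
        = (LINT x|torus L. u 0 x \<bullet> \<phi> 0 x))"


section \<open>Littlewood-Paley projections\<close>

definition dyadic :: "real \<Rightarrow> int \<Rightarrow> real" where
  "dyadic L q = 2 powi q / L"

text \<open>The support in the closed unit ball makes \<^term>\<open>chi\<close> compactly supported.\<close>

definition lp_cutoff :: "(real^3 \<Rightarrow> real) \<Rightarrow> bool" where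
  "lp_cutoff chi \<longleftrightarrow>
     smooth_on UNIV chi \<and>
     (\<forall>\<xi>. 0 \<le> chi \<xi>) \<and>
     (\<forall>\<xi> \<eta>. norm \<xi> = norm \<eta> \<longrightarrow> chi \<xi> = chi \<eta>) \<and>
     (\<forall>\<xi>. norm \<xi> \<le> 3/4 \<longrightarrow> chi \<xi> = 1) \<and>
     (\<forall>\<xi>. 1 \<le> norm \<xi> \<longrightarrow> chi \<xi> = 0)"

text \<open>Used for \<open>q \<ge> -1\<close> only.\<close>

definition lp_symbol :: "(real^3 \<Rightarrow> real) \<Rightarrow> int \<Rightarrow> real^3 \<Rightarrow> real" where
  "lp_symbol chi q \<xi> =
     (if q = -1 then chi \<xi>
      else (let \<eta> = (2 powi (-q)) *\<^sub>R \<xi> in chi ((1/2) *\<^sub>R \<eta>) - chi \<eta>))"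

definition freq :: "int^3 \<Rightarrow> real^3" where
  "freq k = (\<chi> i. of_int (k $ i))"

definition fourier_coeff :: "real \<Rightarrow> (real^3 \<Rightarrow> real^3) \<Rightarrow> int^3 \<Rightarrow> complex^3" where
  "fourier_coeff L v k =
     (\<chi> i. (LINT x|torus L. of_real (v x $ i) * cis (- (2 * pi / L) * (freq k \<bullet> x))) / of_real (L ^ 3))"

text \<open>Only finitely many terms of the series are nonzero.\<close>

definition lp_block ::
  "(real^3 \<Rightarrow> real) \<Rightarrow> real \<Rightarrow> int \<Rightarrow> (real^3 \<Rightarrow> real^3) \<Rightarrow> real^3 \<Rightarrow> complex^3" where
  "lp_block chi L q v x =
     (\<Sum>\<^sub>\<infinity>k. (of_real (lp_symbol chi q (freq k)) * cis ((2 * pi / L) * (freq k \<bullet> x))) *s fourier_coeff L v k)"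

definition lp_low ::
  "(real^3 \<Rightarrow> real) \<Rightarrow> real \<Rightarrow> int \<Rightarrow> (real^3 \<Rightarrow> real^3) \<Rightarrow> real^3 \<Rightarrow> complex^3" where
  "lp_low chi L q v x = (\<Sum>p\<in>{-1..q}. lp_block chi L p v x)"


section \<open>The determining wavenumber\<close>

definition Lr_norm :: "real \<Rightarrow> real \<Rightarrow> (real^3 \<Rightarrow> complex^3) \<Rightarrow> ereal" where
  "Lr_norm L r g =
     (if integrable (torus L) (\<lambda>x. norm (g x) powr r)
      then ereal ((LINT x|torus L. norm (g x) powr r) powr (1 / r)) else \<infinity>)"

definition Linf_norm :: "real \<Rightarrow> (real^3 \<Rightarrow> complex^3) \<Rightarrow> ereal" where
  "Linf_norm L g = esssup (torus L) (\<lambda>x. ereal (norm (g x)))"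

text \<open>The infimum is a minimum, since a nonempty set of numbers \<open>\<lambda>\<^sub>q\<close> with natural \<open>q\<close> has a least
  element; for the empty set it is \<open>\<infinity>\<close>. The last argument is the velocity field at a fixed time.\<close>

definition determining_wavenumber ::
  "(real^3 \<Rightarrow> real) \<Rightarrow> real \<Rightarrow> real \<Rightarrow> real \<Rightarrow> real \<Rightarrow> (real^3 \<Rightarrow> real^3) \<Rightarrow> ereal" where
  "determining_wavenumber chi r c L \<nu> v =
     Inf {ereal (dyadic L (int q)) | q :: nat.
       (\<forall>p > int q. ereal (dyadic L p powr (-1 + 3 / r)) * Lr_norm L r (lp_block chi L p v) < ereal (c * \<nu>)) \<and>
       ereal (1 / dyadic L (int q)) * Linf_norm L (lp_low chi L (int q) v) < ereal (c * \<nu>)}"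

end

theory Submission
  imports Defs
begin

text \<open>
  Write \<open>X = \<parallel>\<nabla>u(t)\<parallel>\<^sup>2\<close> in \<open>L\<^sup>2\<close>. Bessel's inequality for the weak gradient gives
  \<open>L \<Sum>\<^sub>k |k|\<^sup>2 |u\<^sub>k|\<^sup>2 \<le> X\<close> for the Fourier coefficients \<open>u\<^sub>k\<close>. The \<open>q\<close>-th Littlewood-Paley
  block lives on frequencies \<open>|k| \<sim> 2\<^sup>q\<close>, of which there are \<open>O(8\<^sup>q)\<close>. Cauchy-Schwarz and Parseval
  therefore bound its sup norm by \<open>A \<surd>\<lambda>\<^sub>q\<close> and its \<open>L\<^sup>2\<close> norm by \<open>A / \<lambda>\<^sub>q\<close>, with \<open>A\<close> a multiple of
  \<open>\<surd>X\<close>. Interpolating between the two, \<open>\<lambda>\<^sub>q\<close> to the power \<open>-1 + 3/r\<close> times the \<open>L\<^sup>r\<close> norm is at most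
  \<open>A / \<surd>\<lambda>\<^sub>q\<close>; summing the geometric series of sup norms, \<open>1 / \<lambda>\<^sub>q\<close> times the sup norm of the
  low-frequency part is at most \<open>4 A / \<surd>\<lambda>\<^sub>q\<close>. Both defining conditions of the determining
  wavenumber thus hold as soon as \<open>\<lambda>\<^sub>q\<close> exceeds a multiple of \<open>X / \<nu>\<^sup>2\<close>, and the least such
  \<open>\<lambda>\<^sub>q\<close> is either \<open>\<lambda>\<^sub>0\<close> or at most twice that multiple.
\<close>

section \<open>Fourier modes on the torus\<close>

text \<open>Fubini: \<open>lborel\<close> is the image of the product of one-dimensional Lebesgue
  measures under the coordinate map, and there the integral of a product splits.\<close>

lemma integral_lborel_prod_Basis:
  fixes f :: "'a::euclidean_space \<Rightarrow> real \<Rightarrow> 'b::{real_normed_field, banach, second_countable_topology}"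
  assumes int: "\<And>b. b \<in> Basis \<Longrightarrow> integrable lborel (f b)"
  shows "(LINT x|lborel. (\<Prod>b\<in>Basis. f b (x \<bullet> b))) = (\<Prod>b\<in>Basis. LINT t|lborel. f b t)"
proof -
  interpret product_sigma_finite "\<lambda>_::'a. lborel :: real measure" ..
  have [measurable]: "f b \<in> borel_measurable borel" if "b \<in> Basis" for b
    using borel_measurable_integrable[OF int[OF that]] by simp
  have "(LINT x|lborel. (\<Prod>b\<in>Basis. f b (x \<bullet> b))) =
      (LINT x|(\<Pi>\<^sub>M b\<in>Basis. lborel). (\<Prod>b\<in>Basis. f b ((\<Sum>c\<in>Basis. x c *\<^sub>R c) \<bullet> b)))"
    by (subst lborel_eq) (simp add: integral_distr del: inner_sum_left_Basis)
  also have "\<dots> = (LINT x|(\<Pi>\<^sub>M b\<in>Basis. lborel). (\<Prod>b\<in>Basis. f b (x b)))"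
    by simp
  also have "\<dots> = (\<Prod>b\<in>Basis. LINT t|lborel. f b t)"
    by (rule product_integral_prod) (use int in auto)
  finally show ?thesis .
qed

lemma cis_sum: "finite A \<Longrightarrow> cis (\<Sum>a\<in>A. f a) = (\<Prod>a\<in>A. cis (f a))"
  by (simp add: cis_conv_exp sum_distrib_left exp_sum)

text \<open>For nonzero \<open>n\<close> the antiderivative \<open>cis (w * t) / (\<i> * w)\<close>
  takes the same value at both ends, because \<open>w * L\<close> is an integer multiple of
  \<open>2 * pi\<close>.\<close>

lemma integral_Icc_cis:
  assumes "0 < L"
  shows "(LINT t|lborel. indicator {0..L} t *\<^sub>R cis ((2 * pi / L) * (of_int n * t)))
    = (if n = 0 then of_real L else 0)"
proof (cases "n = 0")
  case True
  have "(LINT t|lborel. indicator {0..L} t *\<^sub>R (1::complex)) = of_real L"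
    using assms by (simp add: scaleR_conv_of_real)
  then show ?thesis using True by (simp add: cis_conv_exp)
next
  case False
  define w where "w = 2 * pi / L * of_int n"
  have w: "w \<noteq> 0" using False assms by (simp add: w_def)
  define F where "F = (\<lambda>t::real. cis (w * t) / (\<i> * of_real w))"
  have der: "(F has_vector_derivative cis (w * t)) (at t within {0..L})" for t
  proof -
    have "((\<lambda>z. exp (\<i> * of_real w * z) / (\<i> * of_real w)) has_field_derivative
        exp (\<i> * of_real w * of_real t)) (at (of_real t))"
      using w by (auto intro!: derivative_eq_intros)
    then have "((\<lambda>t. exp (\<i> * of_real w * of_real t) / (\<i> * of_real w)) has_vector_derivative
        exp (\<i> * of_real w * of_real t)) (at t within {0..L})"
      by (rule has_vector_derivative_real_field)
    then show ?thesis by (simp add: F_def cis_conv_exp mult.assoc)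
  qed
  have "F L = F 0"
  proof -
    have "w * L = 2 * pi * of_int n" using assms by (simp add: w_def)
    then have "cis (w * L) = 1"
      by (metis Ints_of_int cis_multiple_2pi)
    then show ?thesis by (simp add: F_def)
  qed
  moreover have "(LINT t|lborel. indicator {0..L} t *\<^sub>R cis (w * t)) = F L - F 0"
    by (rule integral_FTC_Icc) (use assms der in \<open>auto intro!: continuous_intros\<close>)
  ultimately show ?thesis using False by (simp add: w_def mult.assoc)
qed

text \<open>The characters of the torus, not normalised: their modulus is 1, so factors of the
  volume \<open>L ^ 3\<close> appear in Parseval and Bessel below.\<close>

definition fmode :: "real \<Rightarrow> int^3 \<Rightarrow> real^3 \<Rightarrow> complex" where
  "fmode L k x = cis ((2 * pi / L) * (freq k \<bullet> x))"

lemma finite_measure_torus: "finite_measure (torus L)"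
  unfolding torus_def by (rule finite_measure_lebesgue_on) simp

lemma continuous_measurable_torus:
  fixes g :: "real^3 \<Rightarrow> 'b::euclidean_space"
  shows "continuous_on UNIV g \<Longrightarrow> g \<in> borel_measurable (torus L)"
  unfolding torus_def
  by (intro continuous_imp_measurable_on_sets_lebesgue) (auto intro: continuous_on_subset)

lemma bounded_integrable_torus:
  fixes g :: "real^3 \<Rightarrow> 'b::euclidean_space"
  assumes "continuous_on UNIV g" "\<And>x. norm (g x) \<le> B"
  shows "integrable (torus L) g"
  using finite_measure.integrable_const_bound[OF finite_measure_torus] assms
    continuous_measurable_torus by blast

text \<open>Moves the integral to \<open>lborel\<close>, where Fubini is available; a continuous
  integrand is Borel, so completing the measure does not change its integral.\<close>

lemma integral_torus:
  fixes g :: "real^3 \<Rightarrow> 'b::euclidean_space"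
  assumes "continuous_on UNIV g"
  shows "(LINT x|torus L. g x) = (LINT x|lborel. indicator (cbox 0 (vec L)) x *\<^sub>R g x)"
proof -
  have "g \<in> borel_measurable borel" using assms by (rule borel_measurable_continuous_onI)
  then have "(\<lambda>x. indicator (cbox 0 (vec L)) x *\<^sub>R g x) \<in> borel_measurable lborel"
    by (intro borel_measurable_scaleR) (auto intro!: borel_measurable_indicator)
  then show ?thesis
    by (simp add: torus_def integral_restrict_space integral_completion)
qed

lemma continuous_fmode [continuous_intros]: "continuous_on S (fmode L k)"
  unfolding fmode_def by (intro continuous_intros)

lemma norm_fmode [simp]: "norm (fmode L k x) = 1"
  by (simp add: fmode_def)

lemma fmode_mult_cnj: "fmode L k x * cnj (fmode L l x) = fmode L (k - l) x"
  by (simp add: fmode_def cis_cnj cis_mult freq_def inner_vec_def sum_subtractf algebra_simps)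

text \<open>The indicator of the box and the character both factor over the coordinates, so Fubini
  reduces the claim to one dimension. A single nonzero component of \<open>k\<close> annihilates the
  product.\<close>

lemma integral_fmode:
  assumes "0 < L"
  shows "(LINT x|torus L. fmode L k x) = (if k = 0 then of_real (L ^ 3) else 0)"
proof -
  define f where "f = (\<lambda>(b::real^3) t. indicator {0..L} t *\<^sub>R cis ((2 * pi / L) * ((freq k \<bullet> b) * t)))"
  have "(LINT x|torus L. fmode L k x) = (LINT x|lborel. indicator (cbox 0 (vec L)) x *\<^sub>R fmode L k x)"
    by (intro integral_torus continuous_intros)
  also have "\<dots> = (LINT x|lborel. (\<Prod>b\<in>Basis. f b (x \<bullet> b)))"
  proof (intro Bochner_Integration.integral_cong refl)
    fix x :: "real^3"
    have "indicator (cbox 0 (vec L)) x = (\<Prod>b\<in>Basis. indicator {0..L} (x \<bullet> b) :: real)"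
    proof (cases "x \<in> cbox 0 (vec L)")
      case True
      then have "x \<bullet> b \<in> {0..L}" if "b \<in> Basis" for b
        using that by (auto simp: cbox_def Basis_vec_def inner_axis)
      with True show ?thesis by simp
    next
      case False
      then obtain i where "x $ i \<notin> {0..L}"
        by (auto simp: mem_box_cart)
      then have b: "axis i 1 \<in> (Basis :: (real^3) set)" "x \<bullet> axis i 1 \<notin> {0..L}"
        by (auto simp: inner_axis)
      with False show ?thesis 
      proof -
        have "(\<Prod>b\<in>Basis. indicator {0..L} (x \<bullet> b) :: real) = 0"
          using b by (intro prod_zero) (auto intro!: bexI[of _ "axis i 1"])
        with False show ?thesis by simp
      qed
    qed
    moreover have "fmode L k x = (\<Prod>b\<in>Basis. cis ((2 * pi / L) * ((freq k \<bullet> b) * (x \<bullet> b))))"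
      unfolding fmode_def by (subst euclidean_inner) (simp add: sum_distrib_left cis_sum)
    ultimately show "indicator (cbox 0 (vec L)) x *\<^sub>R fmode L k x = (\<Prod>b\<in>Basis. f b (x \<bullet> b))"
      by (simp add: f_def scaleR_conv_of_real prod.distrib)
  qed
  also have "\<dots> = (\<Prod>b\<in>Basis. LINT t|lborel. f b t)"
    unfolding f_def
    by (intro integral_lborel_prod_Basis borel_integrable_compact continuous_intros) auto
  also have "\<dots> = (if k = 0 then of_real (L ^ 3) else 0)"
  proof (cases "k = 0")
    case True
    then have "freq k = 0" by (simp add: freq_def vec_eq_iff)
    then have "(LINT t|lborel. f b t) = of_real L" for b
      using integral_Icc_cis[OF assms, of 0] by (simp add: f_def)
    then show ?thesis using True by simp
  next
    case False
    then obtain i where i: "k $ i \<noteq> 0" by (auto simp: vec_eq_iff)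
    have "(LINT t|lborel. f (axis i 1) t) = 0"
      using integral_Icc_cis[OF assms, of "k $ i"] i by (simp add: f_def inner_axis freq_def)
    then have "(\<Prod>b\<in>Basis. LINT t|lborel. f b t) = 0"
      by (intro prod_zero) (auto intro!: bexI[of _ "axis i 1"])
    then show ?thesis using False by simp
  qed
  finally show ?thesis .
qed

section \<open>Parseval for trigonometric polynomials and Bessel's inequality\<close>

lemma norm_sum_fmode_le: "norm (\<Sum>k\<in>K. a k * fmode L k x) \<le> (\<Sum>k\<in>K. norm (a k))"
  by (rule sum_norm_le) (simp add: norm_mult)

text \<open>Expand the square into a double sum of characters with frequencies \<open>k - l\<close>;
  orthogonality leaves only the diagonal.\<close>

lemma integral_fmode_polynomial:
  assumes "0 < L" "finite K"
  shows "(LINT x|torus L. (norm (\<Sum>k\<in>K. a k * fmode L k x))\<^sup>2) = L ^ 3 * (\<Sum>k\<in>K. (norm (a k))\<^sup>2)"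
proof -
  have int: "integrable (torus L) (\<lambda>x. a k * cnj (a l) * fmode L (k - l) x)" for k l
    by (rule bounded_integrable_torus[of _ "norm (a k * cnj (a l))"])
      (auto intro!: continuous_intros simp: norm_mult)
  have "complex_of_real (LINT x|torus L. (norm (\<Sum>k\<in>K. a k * fmode L k x))\<^sup>2)
      = (LINT x|torus L. complex_of_real ((norm (\<Sum>k\<in>K. a k * fmode L k x))\<^sup>2))"
    by (rule integral_complex_of_real[symmetric])
  also have "\<dots> = (LINT x|torus L. (\<Sum>k\<in>K. \<Sum>l\<in>K. a k * cnj (a l) * fmode L (k - l) x))"
    by (intro Bochner_Integration.integral_cong refl)
      (simp only: complex_norm_square cnj_sum sum_product complex_cnj_mult
        fmode_mult_cnj[symmetric] mult_ac)
  also have "\<dots> = (\<Sum>k\<in>K. \<Sum>l\<in>K. a k * cnj (a l) * (LINT x|torus L. fmode L (k - l) x))"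
    using int by (simp add: Bochner_Integration.integral_sum)
  also have "\<dots> = (\<Sum>k\<in>K. \<Sum>l\<in>K. if k = l then of_real (L ^ 3) * (a k * cnj (a k)) else 0)"
    by (intro sum.cong refl) (auto simp: integral_fmode[OF assms(1)])
  also have "\<dots> = of_real (L ^ 3 * (\<Sum>k\<in>K. (norm (a k))\<^sup>2))"
    using assms by (simp only: sum_distrib_left complex_norm_square of_real_mult of_real_sum sum.delta' sum.delta) simp
  finally show ?thesis by (simp only: of_real_eq_iff)
qed

lemma integrable_mult_cnj_fmode:
  assumes "integrable (torus L) h"
  shows "integrable (torus L) (\<lambda>x. h x * cnj (fmode L k x))"
proof (rule Bochner_Integration.integrable_bound[OF assms])
  have "(\<lambda>x. cnj (fmode L k x)) \<in> borel_measurable (torus L)"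
    by (intro continuous_measurable_torus continuous_intros)
  then show "(\<lambda>x. h x * cnj (fmode L k x)) \<in> borel_measurable (torus L)"
    using borel_measurable_integrable[OF assms] by simp
qed (simp add: norm_mult)

lemma integrable_in_L2:
  assumes "in_L2 L v"
  shows "integrable (torus L) v"
proof -
  interpret finite_measure "torus L" by (rule finite_measure_torus)
  have m: "v \<in> borel_measurable (torus L)" and i: "integrable (torus L) (\<lambda>x. (norm (v x))\<^sup>2)"
    using assms by (auto simp: in_L2_def)
  have "integrable (torus L) (\<lambda>x. norm (v x))"
    by (rule square_integrable_imp_integrable[OF _ i]) (use m in measurable)
  then show ?thesis using m integrable_norm_iff by blast
qed

text \<open>Integrate \<open>(norm (h - P))\<^sup>2 \<ge> 0\<close> for the partial Fourier sum
  \<open>P\<close>: the real cross term and the square of \<open>P\<close> have the same integral.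
  The coefficients enter through an assumption, so that the computed coefficients of a weak gradient
  can be inserted directly.\<close>

lemma Bessel_torus:
  assumes L: "0 < L" and K: "finite K"
    and h: "in_L2 L h"
    and a: "\<And>k. k \<in> K \<Longrightarrow> (LINT x|torus L. h x * cnj (fmode L k x)) = of_real (L ^ 3) * a k"
  shows "L ^ 3 * (\<Sum>k\<in>K. (norm (a k))\<^sup>2) \<le> (LINT x|torus L. (norm (h x :: complex))\<^sup>2)"
proof -
  define P where "P = (\<lambda>x. \<Sum>k\<in>K. a k * fmode L k x)"
  note him = integrable_mult_cnj_fmode[OF integrable_in_L2[OF h]]
  have hP: "h x * cnj (P x) = (\<Sum>k\<in>K. cnj (a k) * (h x * cnj (fmode L k x)))" for x
    by (simp add: P_def sum_distrib_left mult_ac)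
  have ihP: "integrable (torus L) (\<lambda>x. h x * cnj (P x))"
    unfolding hP using him by (intro Bochner_Integration.integrable_sum) simp
  have "(LINT x|torus L. h x * cnj (P x)) = (\<Sum>k\<in>K. cnj (a k) * (LINT x|torus L. h x * cnj (fmode L k x)))"
    unfolding hP using him by (simp add: Bochner_Integration.integral_sum)
  also have "\<dots> = (\<Sum>k\<in>K. of_real (L ^ 3) * (a k * cnj (a k)))"
    by (intro sum.cong refl) (simp add: a)
  also have "\<dots> = of_real (L ^ 3 * (\<Sum>k\<in>K. (norm (a k))\<^sup>2))"
    by (simp only: sum_distrib_left complex_norm_square of_real_mult of_real_sum)
  \<comment> \<open>The pairing of \<open>h\<close> with \<open>P\<close> is already real, so taking
    real parts loses nothing.\<close>
  finally have cross: "(LINT x|torus L. Re (h x * cnj (P x))) = L ^ 3 * (\<Sum>k\<in>K. (norm (a k))\<^sup>2)"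
    using integral_Re[OF ihP] by (simp only: Re_complex_of_real)
  have PP: "(LINT x|torus L. (norm (P x))\<^sup>2) = L ^ 3 * (\<Sum>k\<in>K. (norm (a k))\<^sup>2)"
    unfolding P_def by (rule integral_fmode_polynomial[OF L K])
  have iP: "integrable (torus L) (\<lambda>x. (norm (P x))\<^sup>2)"
    by (rule bounded_integrable_torus[of _ "(\<Sum>k\<in>K. norm (a k))\<^sup>2"])
      (auto simp: P_def intro!: continuous_intros power_mono norm_sum_fmode_le)
  have "0 \<le> (LINT x|torus L. (norm (h x))\<^sup>2 - 2 * Re (h x * cnj (P x)) + (norm (P x))\<^sup>2)"
  proof (rule Bochner_Integration.integral_nonneg)
    fix x
    have "(norm (h x))\<^sup>2 - 2 * Re (h x * cnj (P x)) + (norm (P x))\<^sup>2 = (norm (h x - P x))\<^sup>2"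
      by (simp add: cmod_power2) (simp add: power2_eq_square algebra_simps)
    then show "0 \<le> (norm (h x))\<^sup>2 - 2 * Re (h x * cnj (P x)) + (norm (P x))\<^sup>2" by simp
  qed
  also have "\<dots> = (LINT x|torus L. (norm (h x))\<^sup>2) - 2 * (LINT x|torus L. Re (h x * cnj (P x)))
      + (LINT x|torus L. (norm (P x))\<^sup>2)"
  proof -
    have "integrable (torus L) (\<lambda>x. 2 * Re (h x * cnj (P x)))"
      using integrable_Re[OF ihP] by (rule integrable_mult_right)
    then show ?thesis using h iP by (simp add: in_L2_def del: times_complex.simps)
  qed
  finally show ?thesis using cross PP by simp
qed

section \<open>Fourier coefficients of the weak gradient\<close>

text \<open>A derivative in direction \<open>v\<close> stays in the family: the amplitude gains the
  factor \<open>w \<bullet> v\<close> and the phase moves by \<open>pi/2\<close>. The induction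
  therefore runs over all amplitudes and phases at once.\<close>

lemma Ck_on_cos_affine: "Ck_on n UNIV (\<lambda>x::'a::real_inner. a * cos (w \<bullet> x + b))"
proof (induction n arbitrary: a b)
  case 0
  show ?case by (simp, intro continuous_intros)
next
  case (Suc n)
  have der: "((\<lambda>x. a * cos (w \<bullet> x + b)) has_derivative
      (\<lambda>v. (a * (w \<bullet> v)) * cos (w \<bullet> x + (b + pi/2)))) (at x)" for x
    by (rule derivative_eq_intros refl)+ (simp add: cos_add sin_add algebra_simps)
  then have "(\<lambda>x. a * cos (w \<bullet> x + b)) differentiable_on UNIV"
    by (auto simp: differentiable_on_def differentiable_def)
  moreover have "frechet_derivative (\<lambda>x. a * cos (w \<bullet> x + b)) (at x)
      = (\<lambda>v. (a * (w \<bullet> v)) * cos (w \<bullet> x + (b + pi/2)))" for x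
    using frechet_derivative_at[OF der] by simp
  ultimately show ?case using Suc.IH by simp
qed

lemma smooth_on_cos_affine: "smooth_on UNIV (\<lambda>x::'a::real_inner. cos (w \<bullet> x + b))"
  using Ck_on_cos_affine[of _ 1 w b] by (simp add: smooth_on_def)

lemma partial_cos_affine: "partial j (\<lambda>x. cos (w \<bullet> x + b)) x = - (w $ j) * sin (w \<bullet> x + b)"
proof -
  have "((\<lambda>x. cos (w \<bullet> x + b)) has_derivative (\<lambda>v. - (w \<bullet> v) * sin (w \<bullet> x + b))) (at x)"
    by (rule derivative_eq_intros refl)+ (simp add: algebra_simps)
  from frechet_derivative_at[OF this, symmetric] show ?thesis
    by (simp add: partial_def inner_axis)
qed

lemma integrable_in_L2_nth_nth:
  fixes G :: "real^3 \<Rightarrow> real^3^3"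
  assumes "in_L2 L G"
  shows "integrable (torus L) (\<lambda>x. G x $ i $ j)"
  by (intro integrable_bounded_linear[OF bounded_linear_vec_nth] integrable_in_L2 assms)

lemma norm_vec_power2: "(norm (x :: 'a::real_normed_vector ^ 'n))\<^sup>2 = (\<Sum>i\<in>UNIV. (norm (x $ i))\<^sup>2)"
  by (simp add: norm_vec_def L2_set_def sum_nonneg)

lemma norm_vector_smult: "norm (a *s x) = norm a * norm (x :: 'a::real_normed_field ^ 'n)"
  by (rule power2_eq_imp_eq)
    (simp_all add: power_mult_distrib norm_vec_power2 norm_mult sum_distrib_left)

lemma fourier_coeff_nth:
  "fourier_coeff L v k $ i = (LINT x|torus L. of_real (v x $ i) * cnj (fmode L k x)) / of_real (L ^ 3)"
  by (simp add: fourier_coeff_def fmode_def cis_cnj)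

text \<open>The weak gradient is defined by real test functions, so complex coefficients are split
  into cosine and sine integrals.\<close>

lemma integral_of_real_cnj_fmode:
  assumes "integrable (torus L) h"
  shows "(LINT x|torus L. of_real (h x) * cnj (fmode L k x)) =
    Complex (LINT x|torus L. h x * cos ((2 * pi / L) * (freq k \<bullet> x)))
      (- (LINT x|torus L. h x * sin ((2 * pi / L) * (freq k \<bullet> x))))"
proof -
  have int: "integrable (torus L) (\<lambda>x. complex_of_real (h x) * cnj (fmode L k x))"
    by (rule integrable_mult_cnj_fmode) (use assms in simp)
  show ?thesis
    using integral_Re[OF int] integral_Im[OF int] by (intro complex_eqI) (simp_all add: fmode_def)
qed

text \<open>Differentiation multiplies a Fourier coefficient by the wave vector and
  \<open>\<i>\<close>. The weak gradient is tested against shifted cosines, admissible because they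
  are smooth and \<open>L\<close>-periodic.\<close>

lemma integral_weak_grad_cnj_fmode:
  assumes L: "0 < L" and v: "in_L2 L v" and G: "is_weak_grad L v G"
  shows "(LINT x|torus L. of_real (G x $ i $ j) * cnj (fmode L k x)) =
    of_real (L ^ 3) * (\<i> * of_real (2 * pi / L * (freq k $ j)) * fourier_coeff L v k $ i)"
proof -
  define w where "w = (2 * pi / L) *\<^sub>R freq k"
  have periodic: "periodic L (\<lambda>x. cos (w \<bullet> x + b))" for b
  proof -
    \<comment> \<open>A shift by \<open>L\<close> along axis \<open>i\<close> changes the phase by
      \<open>2 * pi\<close> times the integer \<open>k $ i\<close>.\<close>
    have "cos (w \<bullet> (x + L *\<^sub>R axis i 1) + b) = cos (w \<bullet> x + b)" for x i
    proof -
      have "w \<bullet> (x + L *\<^sub>R axis i 1) + b = (w \<bullet> x + b) + 2 * pi * of_int (k $ i)"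
        using L by (simp add: w_def inner_add_right inner_axis freq_def)
      then show ?thesis by (simp only: cos_add cos_int_2pin sin_int_2pin) simp
    qed
    then show ?thesis by (simp add: periodic_def)
  qed
  have ibp: "(LINT x|torus L. v x $ i * (- (w $ j) * sin (w \<bullet> x + b)))
      = - (LINT x|torus L. G x $ i $ j * cos (w \<bullet> x + b))" for b
    using G periodic[of b] smooth_on_cos_affine[of w b] unfolding is_weak_grad_def
    by (metis (no_types, lifting) Bochner_Integration.integral_cong partial_cos_affine)
  have c: "(LINT x|torus L. G x $ i $ j * cos (w \<bullet> x)) = w $ j * (LINT x|torus L. v x $ i * sin (w \<bullet> x))"
    using ibp[of 0] by (simp add: mult.left_commute)
  \<comment> \<open>The phase \<open>- (pi / 2)\<close> turns the cosine test function into the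
    sine.\<close>
  have s: "(LINT x|torus L. G x $ i $ j * sin (w \<bullet> x)) = - (w $ j) * (LINT x|torus L. v x $ i * cos (w \<bullet> x))"
    using ibp[of "- (pi / 2)"] by (simp add: cos_diff sin_diff mult.left_commute)
  have iv: "integrable (torus L) (\<lambda>x. v x $ i)"
    using integrable_in_L2[OF v] by (rule integrable_bounded_linear[OF bounded_linear_vec_nth])
  have iG: "integrable (torus L) (\<lambda>x. G x $ i $ j)"
    using G by (intro integrable_in_L2_nth_nth) (simp add: is_weak_grad_def)
  have wx: "(2 * pi / L) * (freq k \<bullet> x) = w \<bullet> x" for x
    by (simp add: w_def)
  have wj: "2 * pi / L * (freq k $ j) = w $ j"
    by (simp add: w_def)
  show ?thesis
    unfolding fourier_coeff_nth integral_of_real_cnj_fmode[OF iv] integral_of_real_cnj_fmode[OF iG] wx wj c s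
    using L by (simp add: complex_eq_iff)
qed

text \<open>Bessel's inequality for each entry of \<open>G\<close>, summed over all entries. The
  square of the factor \<open>2 * pi / L\<close> cancels two of the three powers of
  \<open>L\<close>.\<close>

lemma weak_grad_Bessel:
  assumes L: "0 < L" and v: "in_L2 L v" and G: "is_weak_grad L v G" and K: "finite K"
  shows "L * (\<Sum>k\<in>K. (norm (freq k))\<^sup>2 * (norm (fourier_coeff L v k))\<^sup>2)
    \<le> (LINT x|torus L. (norm (G x))\<^sup>2)"
proof -
  let ?u = "fourier_coeff L v"
  have G2: "G \<in> borel_measurable (torus L)" "integrable (torus L) (\<lambda>x. (norm (G x))\<^sup>2)"
    using G by (auto simp: is_weak_grad_def in_L2_def)
  have m: "(\<lambda>x. G x $ i $ j) \<in> borel_measurable (torus L)" for i j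
    using integrable_in_L2_nth_nth[of L G] G by (auto simp: is_weak_grad_def)
  have le: "(G x $ i $ j)\<^sup>2 \<le> (norm (G x))\<^sup>2" for i j x
    using Finite_Cartesian_Product.norm_nth_le[of "G x $ i" j] Finite_Cartesian_Product.norm_nth_le[of "G x" i]
    by (simp add: abs_le_square_iff[symmetric])
  have int: "integrable (torus L) (\<lambda>x. (G x $ i $ j)\<^sup>2)" for i j
    by (rule Bochner_Integration.integrable_bound[OF G2(2)]) (use m le in auto)
  have comp: "L * (\<Sum>k\<in>K. (freq k $ j)\<^sup>2 * (norm (?u k $ i))\<^sup>2) \<le> (LINT x|torus L. (G x $ i $ j)\<^sup>2)"
    for i j
  proof -
    \<comment> \<open>The factor \<open>(2 * pi)\<^sup>2\<close> is at least 1 and is given away to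
      keep the bound free of \<open>pi\<close>.\<close>
    have "L * (\<Sum>k\<in>K. (freq k $ j)\<^sup>2 * (norm (?u k $ i))\<^sup>2)
        \<le> (2 * pi)\<^sup>2 * (L * (\<Sum>k\<in>K. (freq k $ j)\<^sup>2 * (norm (?u k $ i))\<^sup>2))"
    proof -
      have "1\<^sup>2 \<le> (2 * pi)\<^sup>2" using pi_gt3 by (intro power_mono) auto
      moreover have "0 \<le> L * (\<Sum>k\<in>K. (freq k $ j)\<^sup>2 * (norm (?u k $ i))\<^sup>2)"
        using L by (intro mult_nonneg_nonneg sum_nonneg) auto
      ultimately show ?thesis by (simp add: mult_le_cancel_right1)
    qed
    also have "\<dots> = L ^ 3 * (\<Sum>k\<in>K. (norm (\<i> * of_real (2 * pi / L * (freq k $ j)) * ?u k $ i))\<^sup>2)"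
    proof -
      have "(2 * pi)\<^sup>2 * (L * ((freq k $ j)\<^sup>2 * (norm (?u k $ i))\<^sup>2))
          = L ^ 3 * (norm (\<i> * of_real (2 * pi / L * (freq k $ j)) * ?u k $ i))\<^sup>2" for k
        using L by (simp only: norm_mult norm_ii norm_of_real power_mult_distrib power2_abs power_divide)
          (simp add: field_simps power2_eq_square power3_eq_cube)
      then show ?thesis by (simp only: sum_distrib_left)
    qed
    also have "\<dots> \<le> (LINT x|torus L. (norm (complex_of_real (G x $ i $ j)))\<^sup>2)"
      using m int by (intro Bessel_torus[OF L K] integral_weak_grad_cnj_fmode[OF L v G]) (auto simp: in_L2_def)
    finally show ?thesis by simp
  qed
  have "(\<Sum>k\<in>K. (norm (freq k))\<^sup>2 * (norm (?u k))\<^sup>2)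
      = (\<Sum>k\<in>K. \<Sum>i\<in>UNIV. \<Sum>j\<in>UNIV. (freq k $ j)\<^sup>2 * (norm (?u k $ i))\<^sup>2)"
    by (simp add: norm_vec_power2 sum_product mult.commute) (rule sum.cong[OF refl], rule sum.swap)
  also have "\<dots> = (\<Sum>i\<in>UNIV. \<Sum>j\<in>UNIV. \<Sum>k\<in>K. (freq k $ j)\<^sup>2 * (norm (?u k $ i))\<^sup>2)"
    by (subst sum.swap, rule sum.cong[OF refl], rule sum.swap)
  finally have "L * (\<Sum>k\<in>K. (norm (freq k))\<^sup>2 * (norm (?u k))\<^sup>2)
      = (\<Sum>i\<in>UNIV. \<Sum>j\<in>UNIV. L * (\<Sum>k\<in>K. (freq k $ j)\<^sup>2 * (norm (?u k $ i))\<^sup>2))"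
    by (simp add: sum_distrib_left)
  also have "\<dots> \<le> (\<Sum>i\<in>UNIV. \<Sum>j\<in>UNIV. (LINT x|torus L. (G x $ i $ j)\<^sup>2))"
    by (intro sum_mono comp)
  also have "\<dots> = (LINT x|torus L. (norm (G x))\<^sup>2)"
    using int by (simp add: norm_vec_power2 Bochner_Integration.integral_sum)
  finally show ?thesis .
qed

lemma fourier_coeff_zero:
  assumes "in_L2 L v" "zero_mean L v"
  shows "fourier_coeff L v 0 = 0"
proof -
  have "(LINT x|torus L. v x $ i) = 0" for i
    using integral_bounded_linear[OF bounded_linear_vec_nth integrable_in_L2[OF assms(1)], of i] assms(2)
    by (simp add: zero_mean_def)
  moreover have "fmode L 0 x = 1" for x
    by (simp add: fmode_def freq_def inner_vec_def)
  ultimately show ?thesis by (simp add: vec_eq_iff fourier_coeff_nth)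
qed

section \<open>Littlewood-Paley blocks\<close>

text \<open>The lattice points at which the symbol of block \<open>q\<close> can be nonzero. The
  lower radius controls the coefficients by the gradient, the upper one makes the shell
  finite.\<close>

definition shell :: "nat \<Rightarrow> (int^3) set" where
  "shell q = {k. 3/4 * 2 ^ q \<le> norm (freq k) \<and> norm (freq k) \<le> 2 * 2 ^ q}"

text \<open>The shell sits in a cube of lattice points with
  \<open>4 * 2 ^ q + 1 \<le> 5 * 2 ^ q\<close> values per coordinate.\<close>

lemma card_shell: "finite (shell q) \<and> real (card (shell q)) \<le> 125 * 8 ^ q"
proof -
  define I where "I = {- (2 * 2 ^ q) .. 2 * 2 ^ q :: int}"
  have sub: "shell q \<subseteq> (\<lambda>(a, b, c). vector [a, b, c]) ` (I \<times> I \<times> I)"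
  proof
    fix k assume "k \<in> shell q"
    then have "\<bar>of_int (k $ i)\<bar> \<le> (2 * 2 ^ q :: real)" for i
      using component_le_norm_cart[of "freq k" i] by (simp add: shell_def freq_def)
    then have "real_of_int \<bar>k $ i\<bar> \<le> real_of_int (2 * 2 ^ q)" for i by simp
    then have "\<bar>k $ i\<bar> \<le> 2 * 2 ^ q" for i by (simp only: of_int_le_iff)
    note this[unfolded abs_le_iff]
    then have "k $ i \<in> I" for i unfolding I_def atLeastAtMost_iff by (metis minus_le_iff)
    moreover have "k = vector [k $ 1, k $ 2, k $ 3]"
      by (simp add: vec_eq_iff forall_3)
    ultimately show "k \<in> (\<lambda>(a, b, c). vector [a, b, c]) ` (I \<times> I \<times> I)"
      by (intro image_eqI[of _ _ "(k $ 1, k $ 2, k $ 3)"]) auto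
  qed
  have fin: "finite (I \<times> I \<times> I)" by (simp add: I_def)
  have "int (card I) = 4 * 2 ^ q + 1" by (simp add: I_def)
  then have "real (card I) = 4 * 2 ^ q + 1"
    by (metis of_int_of_nat_eq of_int_add of_int_mult of_int_numeral of_int_power of_int_1)
  then have cI: "real (card I) \<le> 5 * 2 ^ q" by simp
  have "card (shell q) \<le> card ((\<lambda>(a, b, c). vector [a, b, c] :: int^3) ` (I \<times> I \<times> I))"
    using sub fin by (intro card_mono) auto
  also have "\<dots> \<le> card (I \<times> I \<times> I)" by (rule card_image_le[OF fin])
  finally have "real (card (shell q)) \<le> real (card I) ^ 3"
    by (simp add: card_cartesian_product power3_eq_cube flip: of_nat_mult)
  also have "\<dots> \<le> (5 * 2 ^ q) ^ 3" by (intro power_mono cI) simp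
  also have "\<dots> = 125 * 8 ^ q"
    by (simp add: power_mult_distrib flip: power_mult) (simp add: mult.commute[of q] power_mult)
  finally show ?thesis using sub fin finite_subset by blast
qed

lemma lp_cutoffD:
  assumes "lp_cutoff chi"
  shows "0 \<le> chi \<xi>" "norm \<xi> \<le> 3/4 \<Longrightarrow> chi \<xi> = 1" "1 \<le> norm \<xi> \<Longrightarrow> chi \<xi> = 0"
  using assms unfolding lp_cutoff_def by blast+

text \<open>After rescaling to \<open>\<eta>\<close>, both cutoff values are 1 when the norm is
  below 3/4 and both are 0 when it exceeds 2, so their difference vanishes outside the
  shell.\<close>

lemma lp_symbol_support:
  assumes "lp_cutoff chi" "lp_symbol chi (int q) (freq k) \<noteq> 0"
  shows "k \<in> shell q"
proof -
  define \<eta> where "\<eta> = (2 powi (- int q)) *\<^sub>R freq k"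
  have n: "norm \<eta> = norm (freq k) / 2 ^ q"
    by (simp add: \<eta>_def power_int_minus divide_inverse mult.commute)
  have "chi ((1/2) *\<^sub>R \<eta>) - chi \<eta> \<noteq> 0"
    using assms(2) by (simp add: lp_symbol_def \<eta>_def Let_def)
  moreover have "chi ((1/2) *\<^sub>R \<eta>) - chi \<eta> = 0" if "norm \<eta> < 3/4"
    using that by (simp add: lp_cutoffD[OF assms(1)])
  moreover have "chi ((1/2) *\<^sub>R \<eta>) - chi \<eta> = 0" if "2 < norm \<eta>"
    using that by (simp add: lp_cutoffD[OF assms(1)])
  ultimately have "3/4 \<le> norm \<eta>" "norm \<eta> \<le> 2" by force+
  then show ?thesis by (simp add: n shell_def field_simps)
qed

text \<open>Two values in \<open>[0, M]\<close> differ by at most \<open>M\<close>, so the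
  difference of cutoffs costs no factor 2.\<close>

lemma lp_symbol_bound:
  assumes "lp_cutoff chi" "\<And>\<xi>. chi \<xi> \<le> M"
  shows "\<bar>lp_symbol chi q \<xi>\<bar> \<le> M"
proof -
  have "\<bar>chi a\<bar> \<le> M" "\<bar>chi a - chi b\<bar> \<le> M" for a b
    using assms(2)[of a] assms(2)[of b] lp_cutoffD(1)[OF assms(1), of a] lp_cutoffD(1)[OF assms(1), of b]
    by linarith+
  then show ?thesis by (simp add: lp_symbol_def Let_def)
qed

lemma lp_block_finite:
  assumes "finite K" "\<And>k. k \<notin> K \<Longrightarrow> lp_symbol chi q (freq k) = 0"
  shows "lp_block chi L q v x =
    (\<Sum>k\<in>K. (of_real (lp_symbol chi q (freq k)) * fmode L k x) *s fourier_coeff L v k)"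
proof -
  have "lp_block chi L q v x =
      (\<Sum>\<^sub>\<infinity>k\<in>K. (of_real (lp_symbol chi q (freq k)) * fmode L k x) *s fourier_coeff L v k)"
    unfolding lp_block_def fmode_def by (rule infsum_cong_neutral) (use assms(2) in auto)
  then show ?thesis using assms(1) by simp
qed

text \<open>A nonzero integer vector has norm at least 1, where \<open>chi\<close> vanishes. Only
  the mean mode can contribute to this block, and its coefficient is zero.\<close>

lemma lp_block_minus1:
  assumes "lp_cutoff chi" "fourier_coeff L v 0 = 0"
  shows "lp_block chi L (-1) v x = 0"
proof -
  have "lp_symbol chi (-1) (freq k) = 0" if nz: "k \<noteq> 0" for k
  proof -
    obtain i where "k $ i \<noteq> 0" using nz by (auto simp: vec_eq_iff)
    then have "1 \<le> \<bar>k $ i\<bar>" by linarith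
    then have "1 \<le> \<bar>freq k $ i\<bar>" by (simp add: freq_def)
    also have "\<dots> \<le> norm (freq k)" by (rule component_le_norm_cart)
    finally show ?thesis by (simp add: lp_cutoffD[OF assms(1)] lp_symbol_def)
  qed
  then show ?thesis
    using lp_block_finite[of "{0}" chi "-1"] assms(2) by simp
qed

text \<open>\<open>chi\<close> is bounded on the compact unit ball by continuity and vanishes
  outside it. Taking the maximum with 1 keeps the final constant positive.\<close>

lemma lp_cutoff_bounded:
  assumes "lp_cutoff chi"
  obtains M where "1 \<le> M" "\<And>\<xi>. chi \<xi> \<le> M"
proof -
  have "Ck_on 0 UNIV chi" using assms unfolding lp_cutoff_def smooth_on_def by blast
  then have "compact (chi ` cball 0 1)"
    by (intro compact_continuous_image compact_cball) (auto intro: continuous_on_subset)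
  then have "bounded (chi ` cball 0 1)" by (rule compact_imp_bounded)
  then obtain B where "\<forall>\<xi>\<in>cball 0 1. \<bar>chi \<xi>\<bar> \<le> B"
    by (auto simp: bounded_iff)
  then have B: "norm \<xi> \<le> 1 \<Longrightarrow> \<bar>chi \<xi>\<bar> \<le> B" for \<xi>
    by simp
  show thesis
  proof
    show "1 \<le> max 1 B" by simp
    show "chi \<xi> \<le> max 1 B" for \<xi>
      using B[of \<xi>] lp_cutoffD(3)[OF assms, of \<xi>] by (cases "norm \<xi> \<le> 1") auto
  qed
qed

section \<open>Sup and square-integral bounds for a single block\<close>

lemma dyadic_nat: "dyadic L (int q) = 2 ^ q / L"
  by (simp add: dyadic_def)

lemma lp_block_nat:
  assumes "lp_cutoff chi"
  shows "lp_block chi L (int q) v x =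
    (\<Sum>k\<in>shell q. (of_real (lp_symbol chi (int q) (freq k)) * fmode L k x) *s fourier_coeff L v k)"
  using card_shell lp_symbol_support[OF assms] by (intro lp_block_finite) auto

lemma continuous_lp_block_nat:
  assumes "lp_cutoff chi"
  shows "continuous_on UNIV (lp_block chi L (int q) v)"
proof -
  have "continuous_on UNIV (\<lambda>x. lp_block chi L (int q) v x $ i)" for i
    unfolding lp_block_nat[OF assms] by (simp, intro continuous_intros)
  then have "continuous_on UNIV (\<lambda>x. \<chi> i. lp_block chi L (int q) v x $ i)"
    by (intro continuous_on_vec_lambda)
  then show ?thesis by simp
qed

text \<open>On the shell \<open>norm (freq k)\<close> is at least \<open>3/4 * 2 ^ q\<close>, so the
  gradient bound controls the plain square sum \<open>S\<close> of the coefficients. Cauchy-Schwarz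
  with the shell count turns this into the sup bound, Parseval into the square-integral
  bound.\<close>

lemma lp_block_bounds:
  assumes chi: "lp_cutoff chi" "\<And>\<xi>. chi \<xi> \<le> M" and L: "0 < L"
    and X: "L * (\<Sum>k\<in>shell q. (norm (freq k))\<^sup>2 * (norm (fourier_coeff L v k))\<^sup>2) \<le> X"
  shows norm_lp_block_le: "norm (lp_block chi L (int q) v x) \<le> 15 * M * sqrt X * sqrt (dyadic L (int q))"
    and L2_lp_block_le: "(LINT x|torus L. (norm (lp_block chi L (int q) v x))\<^sup>2)
      \<le> (15 * M * sqrt X / dyadic L (int q))\<^sup>2"
proof -
  let ?u = "fourier_coeff L v" and ?s = "\<lambda>k. lp_symbol chi (int q) (freq k)"
  define S where "S = (\<Sum>k\<in>shell q. (norm (?u k))\<^sup>2)"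
  have fin: "finite (shell q)" and card: "real (card (shell q)) \<le> 125 * 8 ^ q"
    using card_shell by auto
  have M: "0 \<le> M" using lp_cutoffD(1)[OF chi(1), of 0] chi(2)[of 0] by linarith
  have s: "\<bar>?s k\<bar> \<le> M" for k by (rule lp_symbol_bound[OF chi])
  have S0: "0 \<le> S" unfolding S_def by (intro sum_nonneg) simp
  have "9/16 * 4 ^ q * S \<le> (\<Sum>k\<in>shell q. (norm (freq k))\<^sup>2 * (norm (?u k))\<^sup>2)"
    unfolding S_def sum_distrib_left
  proof (intro sum_mono mult_right_mono)
    fix k assume "k \<in> shell q"
    then have "(3/4 * 2 ^ q)\<^sup>2 \<le> (norm (freq k))\<^sup>2"
      by (intro power_mono) (auto simp: shell_def)
    also have "(3/4 * 2 ^ q)\<^sup>2 = 9/16 * (4::real) ^ q"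
      by (simp add: power2_eq_square flip: power_mult_distrib)
    finally show "9/16 * 4 ^ q \<le> (norm (freq k))\<^sup>2" .
  qed simp
  then have "L * (9/16 * 4 ^ q * S) \<le> X"
    using L X by (meson mult_left_mono order_trans less_imp_le)
  then have SX: "S \<le> 16 * X / (9 * 4 ^ q * L)"
    using L by (simp add: field_simps)
  have X0: "0 \<le> X"
    using X L by (meson order_trans mult_nonneg_nonneg sum_nonneg zero_le_power2 less_imp_le)
  show "norm (lp_block chi L (int q) v x) \<le> 15 * M * sqrt X * sqrt (dyadic L (int q))"
  proof (rule power2_le_imp_le)
    have "norm (lp_block chi L (int q) v x) \<le> (\<Sum>k\<in>shell q. \<bar>?s k\<bar> * norm (?u k))"
      unfolding lp_block_nat[OF chi(1)]
      by (rule sum_norm_le) (simp add: norm_vector_smult norm_mult)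
    also have "\<dots> \<le> M * (\<Sum>k\<in>shell q. norm (?u k))"
      unfolding sum_distrib_left by (intro sum_mono mult_right_mono s) simp
    finally have "(norm (lp_block chi L (int q) v x))\<^sup>2 \<le> (M * (\<Sum>k\<in>shell q. norm (?u k)))\<^sup>2"
      by (intro power_mono) auto
    \<comment> \<open>Cauchy-Schwarz against the constant 1 on the shell.\<close>
    also have "\<dots> \<le> M\<^sup>2 * (S * real (card (shell q)))"
      unfolding power_mult_distrib S_def by (intro mult_left_mono sum_squared_le_sum_of_squares) simp
    also have "\<dots> \<le> M\<^sup>2 * (16 * X / (9 * 4 ^ q * L) * (125 * 8 ^ q))"
      using SX card S0 X0 L by (intro mult_left_mono mult_mono) auto
    also have "\<dots> = 2000/9 * M\<^sup>2 * X * (2 ^ q / L)"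
    proof -
      have "(8::real) ^ q = 4 ^ q * 2 ^ q" by (simp flip: power_mult_distrib)
      then show ?thesis using L by (simp add: field_simps)
    qed
    \<comment> \<open>Rounded up to a perfect square, which is the origin of the constant
      15.\<close>
    also have "\<dots> \<le> 225 * M\<^sup>2 * X * (2 ^ q / L)"
      using X0 L by (intro mult_right_mono) auto
    also have "\<dots> = (15 * M * sqrt X * sqrt (dyadic L (int q)))\<^sup>2"
      using X0 L by (simp add: power_mult_distrib dyadic_nat)
    finally show "(norm (lp_block chi L (int q) v x))\<^sup>2 \<le> (15 * M * sqrt X * sqrt (dyadic L (int q)))\<^sup>2" .
  qed (use M X0 L in \<open>simp add: dyadic_nat\<close>)
  have int: "integrable (torus L) (\<lambda>x. (norm (\<Sum>k\<in>shell q. (of_real (?s k) * ?u k $ i) * fmode L k x))\<^sup>2)" for i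
    by (rule bounded_integrable_torus[of _ "(\<Sum>k\<in>shell q. norm (of_real (?s k) * ?u k $ i))\<^sup>2"])
      (auto intro!: continuous_intros power_mono norm_sum_fmode_le simp del: norm_mult)
  have "(LINT x|torus L. (norm (lp_block chi L (int q) v x))\<^sup>2)
      = (LINT x|torus L. (\<Sum>i\<in>UNIV. (norm (\<Sum>k\<in>shell q. (of_real (?s k) * ?u k $ i) * fmode L k x))\<^sup>2))"
    by (simp add: norm_vec_power2 lp_block_nat[OF chi(1)] mult_ac)
  also have "\<dots> = (\<Sum>i\<in>UNIV. L ^ 3 * (\<Sum>k\<in>shell q. (norm (of_real (?s k) * ?u k $ i))\<^sup>2))"
    using int by (simp only: Bochner_Integration.integral_sum integral_fmode_polynomial[OF L fin])
  also have "\<dots> = L ^ 3 * (\<Sum>k\<in>shell q. (?s k)\<^sup>2 * (norm (?u k))\<^sup>2)"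
    unfolding norm_vec_power2 sum_distrib_left
    by (subst sum.swap) (simp add: norm_mult power_mult_distrib)
  also have "\<dots> \<le> L ^ 3 * (M\<^sup>2 * S)"
    unfolding S_def sum_distrib_left using L s M
    by (intro sum_mono mult_left_mono mult_right_mono) (auto simp: abs_le_square_iff[symmetric])
  also have "\<dots> \<le> L ^ 3 * (M\<^sup>2 * (16 * X / (9 * 4 ^ q * L)))"
    using L SX by (intro mult_left_mono) auto
  also have "\<dots> = 16/9 * M\<^sup>2 * X * (L / 2 ^ q)\<^sup>2"
  proof -
    have "(4::real) ^ q = (2 ^ q)\<^sup>2" by (simp add: power2_eq_square flip: power_mult_distrib)
    then show ?thesis using L by (simp add: field_simps power2_eq_square power3_eq_cube)
  qed
  \<comment> \<open>Deliberately weakened so that both bounds share one amplitude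
    \<open>15 * M * sqrt X\<close>.\<close>
  also have "\<dots> \<le> 225 * M\<^sup>2 * X * (L / 2 ^ q)\<^sup>2"
    using X0 by (intro mult_right_mono) auto
  also have "\<dots> = (15 * M * sqrt X / dyadic L (int q))\<^sup>2"
    using X0 by (simp add: power_mult_distrib power_divide dyadic_nat)
  finally show "(LINT x|torus L. (norm (lp_block chi L (int q) v x))\<^sup>2) \<le> (15 * M * sqrt X / dyadic L (int q))\<^sup>2" .
qed

section \<open>From sup and square-integral bounds to the norms in the wavenumber\<close>

lemma Lr_norm_le_interpolation:
  assumes g: "continuous_on UNIV g" and B: "\<And>x. norm (g x) \<le> B" and r: "2 \<le> r"
    and D: "(LINT x|torus L. (norm (g x))\<^sup>2) \<le> D"
  shows "Lr_norm L r g \<le> ereal ((B powr (r - 2) * D) powr (1 / r))"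
proof -
  \<comment> \<open>Split off two powers and bound the remaining \<open>r - 2 \<ge> 0\<close> by the
    sup bound.\<close>
  have le: "norm (g x) powr r \<le> B powr (r - 2) * (norm (g x))\<^sup>2" for x
  proof -
    have "norm (g x) powr r = norm (g x) powr (r - 2) * norm (g x) powr 2"
      by (simp only: powr_add[symmetric]) simp
    also have "\<dots> = norm (g x) powr (r - 2) * (norm (g x))\<^sup>2" by simp
    also have "\<dots> \<le> B powr (r - 2) * (norm (g x))\<^sup>2"
      using r B by (intro mult_right_mono powr_mono2) auto
    finally show ?thesis .
  qed
  have int2: "integrable (torus L) (\<lambda>x. (norm (g x))\<^sup>2)"
    using g B by (intro bounded_integrable_torus[of _ "B\<^sup>2"]) (auto intro!: continuous_intros power_mono)
  have intr: "integrable (torus L) (\<lambda>x. norm (g x) powr r)"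
  proof (rule Bochner_Integration.integrable_bound)
    show "integrable (torus L) (\<lambda>x. B powr (r - 2) * (norm (g x))\<^sup>2)" using int2 by simp
    show "(\<lambda>x. norm (g x) powr r) \<in> borel_measurable (torus L)"
      using g r by (intro continuous_measurable_torus continuous_on_powr' continuous_intros) auto
  qed (use le in \<open>simp add: abs_mult\<close>)
  have "(LINT x|torus L. norm (g x) powr r) \<le> (LINT x|torus L. B powr (r - 2) * (norm (g x))\<^sup>2)"
    using int2 by (intro integral_mono intr le) simp
  also have "\<dots> \<le> B powr (r - 2) * D" using D by (simp add: mult_left_mono)
  finally have "(LINT x|torus L. norm (g x) powr r) powr (1 / r) \<le> (B powr (r - 2) * D) powr (1 / r)"
    using r by (intro powr_mono2) auto
  then show ?thesis using intr by (simp add: Lr_norm_def)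
qed

lemma Linf_norm_le:
  assumes "continuous_on UNIV g" "\<And>x. norm (g x) \<le> B"
  shows "Linf_norm L g \<le> ereal B"
  unfolding Linf_norm_def
proof (rule esssup_I)
  have "(\<lambda>x. norm (g x)) \<in> borel_measurable (torus L)"
    using assms by (intro continuous_measurable_torus continuous_intros)
  then show "(\<lambda>x. ereal (norm (g x))) \<in> borel_measurable (torus L)" by measurable
qed (use assms in simp)

text \<open>Exponent count: before the root, \<open>A\<close> has power \<open>r\<close> and
  \<open>l\<close> has power \<open>r / 2 - 3\<close>. The root gives \<open>l\<close> the power
  \<open>1/2 - 3/r\<close>, and the prefactor leaves \<open>-1/2\<close>. The case
  \<open>A = 0\<close> is trivial and separate.\<close>

lemma Bernstein_exponents:
  assumes "0 \<le> A" "0 < l" "0 < r"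
  shows "l powr (-1 + 3 / r) * ((A * sqrt l) powr (r - 2) * (A / l)\<^sup>2) powr (1 / r) = A / sqrt l"
proof (cases "A = 0")
  case False
  then have A: "0 < A" using assms by simp
  have "(A * sqrt l) powr (r - 2) * (A / l)\<^sup>2 = A powr r * l powr (r / 2 - 3)"
  proof -
    have "(A * sqrt l) powr (r - 2) = A powr (r - 2) * l powr ((r - 2) / 2)"
      using assms A by (simp add: powr_mult powr_powr flip: powr_half_sqrt)
    moreover have "(A / l)\<^sup>2 = A powr 2 * l powr (-2)"
      using assms A by (simp add: powr_minus power_mult_distrib power_inverse divide_inverse)
    ultimately have "(A * sqrt l) powr (r - 2) * (A / l)\<^sup>2
        = (A powr (r - 2) * A powr 2) * (l powr ((r - 2) / 2) * l powr (-2))"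
      by (simp only: mult_ac)
    then show ?thesis by (simp only: powr_add[symmetric]) (simp add: diff_divide_distrib)
  qed
  then have "((A * sqrt l) powr (r - 2) * (A / l)\<^sup>2) powr (1 / r) = A * l powr ((r / 2 - 3) * (1 / r))"
    using assms A by (simp add: powr_mult powr_powr)
  then have "l powr (-1 + 3 / r) * ((A * sqrt l) powr (r - 2) * (A / l)\<^sup>2) powr (1 / r)
      = A * (l powr (-1 + 3 / r) * l powr ((r / 2 - 3) * (1 / r)))"
    by simp
  also have "\<dots> = A * l powr (-1 + 3 / r + (r / 2 - 3) * (1 / r))" by (simp only: powr_add)
  also have "-1 + 3 / r + (r / 2 - 3) * (1 / r) = - (1/2)" using assms by (simp add: field_simps)
  finally show ?thesis using assms by (simp add: powr_minus_divide powr_half_sqrt)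
qed simp

section \<open>Sup norm of the low-frequency part\<close>

lemma lp_low_Suc: "lp_low chi L (int (Suc q)) v x = lp_low chi L (int q) v x + lp_block chi L (int (Suc q)) v x"
proof -
  have "{-1..int (Suc q)} = insert (int (Suc q)) {-1..int q}" by auto
  then show ?thesis by (simp add: lp_low_def add.commute)
qed

lemma lp_low_zero: "lp_low chi L 0 v x = lp_block chi L (-1) v x + lp_block chi L 0 v x"
proof -
  have "{-1..0::int} = {-1, 0}" by auto
  then show ?thesis by (simp add: lp_low_def)
qed

text \<open>The block bounds grow geometrically with ratio \<open>sqrt 2\<close>, so their sum is
  comparable to the last one. A constant \<open>K\<close> survives the induction step when
  \<open>K + sqrt 2 \<le> K * sqrt 2\<close>; 4 is such a value.\<close>

lemma norm_lp_low_le: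
  assumes L: "0 < L" and A: "0 \<le> A"
    and low: "\<And>x. lp_block chi L (-1) v x = 0"
    and block: "\<And>q x. norm (lp_block chi L (int q) v x) \<le> A * sqrt (dyadic L (int q))"
  shows "norm (lp_low chi L (int q) v x) \<le> 4 * A * sqrt (dyadic L (int q))"
proof (induction q)
  case 0
  have "0 \<le> A * sqrt (dyadic L 0)" using A L by (simp add: dyadic_def)
  then show ?case using block[of 0 x] by (simp add: lp_low_zero low)
next
  case (Suc q)
  define l where "l = dyadic L (int q)"
  have l: "0 \<le> l" "dyadic L (int (Suc q)) = 2 * l" using L by (simp_all only: l_def dyadic_nat power_Suc) simp_all
  have "norm (lp_low chi L (int (Suc q)) v x)
      \<le> norm (lp_low chi L (int q) v x) + norm (lp_block chi L (int (Suc q)) v x)"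
    unfolding lp_low_Suc by (rule norm_triangle_ineq)
  also have "\<dots> \<le> 4 * A * sqrt l + A * sqrt (2 * l)"
    using Suc block[of "Suc q" x] by (simp only: l_def l(2)[unfolded l_def] add_mono)
  also have "\<dots> \<le> 4 * A * sqrt (2 * l)"
  proof -
    have "4 \<le> 3 * sqrt 2" by (rule power2_le_imp_le) (auto simp: power_mult_distrib)
    then have "4 * (A * sqrt l) \<le> 3 * sqrt 2 * (A * sqrt l)"
      using A l by (intro mult_right_mono) auto
    then show ?thesis by (simp add: real_sqrt_mult algebra_simps)
  qed
  finally show ?case by (simp only: l(2))
qed

lemma continuous_lp_low:
  assumes "lp_cutoff chi" "\<And>x. lp_block chi L (-1) v x = 0"
  shows "continuous_on UNIV (lp_low chi L (int q) v)"
proof (induction q)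
  case 0
  show ?case using continuous_lp_block_nat[OF assms(1), of L 0 v]
    by (simp add: lp_low_zero[abs_def] assms(2))
next
  case (Suc q)
  show ?case
    unfolding lp_low_Suc[abs_def]
    by (intro continuous_on_add Suc continuous_lp_block_nat[OF assms(1)])
qed

section \<open>The determining wavenumber\<close>

text \<open>The determining wavenumber is an infimum, so it suffices that this \<open>q\<close>
  satisfies both defining conditions.\<close>

lemma determining_wavenumber_le_dyadic:
  assumes chi: "lp_cutoff chi" "\<And>\<xi>. chi \<xi> \<le> M" and r: "2 < r" "r < 3" and c: "0 < c"
    and L: "0 < L" and nu: "0 < \<nu>"
    and v: "in_L2 L v" "zero_mean L v" and G: "is_weak_grad L v G"
    and X: "(LINT x|torus L. (norm (G x))\<^sup>2) = X"
    and q: "3600 * M\<^sup>2 / c\<^sup>2 * X / \<nu>\<^sup>2 < dyadic L (int q)"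
  shows "determining_wavenumber chi r c L \<nu> v \<le> ereal (dyadic L (int q))"
proof -
  have M: "0 \<le> M" using lp_cutoffD(1)[OF chi(1), of 0] chi(2)[of 0] by linarith
  have X0: "0 \<le> X" using X by (metis Bochner_Integration.integral_nonneg zero_le_power2)
  define A where "A = 15 * M * sqrt X"
  have A0: "0 \<le> A" using M X0 by (simp add: A_def)
  have Xs: "L * (\<Sum>k\<in>shell p. (norm (freq k))\<^sup>2 * (norm (fourier_coeff L v k))\<^sup>2) \<le> X" for p
    using weak_grad_Bessel[OF L v(1) G, of "shell p"] card_shell[of p] X by simp
  note block = norm_lp_block_le[OF chi L Xs, folded A_def]
  note block2 = L2_lp_block_le[OF chi L Xs, folded A_def]
  have low: "lp_block chi L (-1) v x = 0" for x
    by (intro lp_block_minus1 chi fourier_coeff_zero v)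
  have pos: "0 < dyadic L (int p)" for p using L by (simp add: dyadic_nat)
  \<comment> \<open>One inequality serves both conditions: \<open>p = q\<close> for the
    low-frequency part, \<open>p > q\<close> for the blocks, which only need \<open>A\<close> in
    place of \<open>4 * A\<close>. The threshold constant is
    \<open>3600 = (4 * 15)\<^sup>2\<close>.\<close>
  have small: "4 * A / sqrt (dyadic L (int p)) < c * \<nu>" if "q \<le> p" for p
  proof -
    have "dyadic L (int q) \<le> dyadic L (int p)"
      using that L by (simp add: dyadic_nat divide_right_mono power_increasing)
    then have "3600 * M\<^sup>2 / c\<^sup>2 * X / \<nu>\<^sup>2 < dyadic L (int p)" using q by linarith
    then have "(4 * A)\<^sup>2 < (c * \<nu>)\<^sup>2 * dyadic L (int p)"
      using c nu X0 by (simp add: A_def power_mult_distrib field_simps)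
    also have "\<dots> = (c * \<nu> * sqrt (dyadic L (int p)))\<^sup>2"
      using pos[of p] by (simp add: power_mult_distrib)
    finally have "4 * A < c * \<nu> * sqrt (dyadic L (int p))"
      by (rule power2_less_imp_less) (use c nu pos[of p] in simp)
    then show ?thesis using pos[of p] by (simp add: divide_less_eq)
  qed
  have high: "ereal (dyadic L p powr (-1 + 3 / r)) * Lr_norm L r (lp_block chi L p v) < ereal (c * \<nu>)"
    if "int q < p" for p
  proof -
    obtain n where n: "p = int n" "q \<le> n"
      using \<open>int q < p\<close> by (metis int_ops(1) nonneg_int_cases of_nat_0_le_iff of_nat_less_iff order.strict_trans1 less_imp_le)
    let ?l = "dyadic L (int n)"
    have "Lr_norm L r (lp_block chi L p v) \<le> ereal (((A * sqrt ?l) powr (r - 2) * (A / ?l)\<^sup>2) powr (1 / r))"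
      unfolding n(1) using r
      by (intro Lr_norm_le_interpolation continuous_lp_block_nat chi block block2) auto
    then have "ereal (?l powr (-1 + 3 / r)) * Lr_norm L r (lp_block chi L p v)
        \<le> ereal (?l powr (-1 + 3 / r)) * ereal (((A * sqrt ?l) powr (r - 2) * (A / ?l)\<^sup>2) powr (1 / r))"
      by (rule ereal_mult_left_mono) simp
    also have "\<dots> = ereal (A / sqrt ?l)"
      using Bernstein_exponents[OF A0 pos] r by simp
    also have "\<dots> < ereal (c * \<nu>)"
    proof -
      have "A / sqrt ?l \<le> 4 * A / sqrt ?l" using A0 pos[of n] by (intro divide_right_mono) auto
      then show ?thesis using small[OF n(2)] by simp
    qed
    finally show ?thesis by (simp add: n(1))
  qed
  have "ereal (1 / dyadic L (int q)) * Linf_norm L (lp_low chi L (int q) v)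
      \<le> ereal (1 / dyadic L (int q)) * ereal (4 * A * sqrt (dyadic L (int q)))"
    using pos[of q]
    by (intro ereal_mult_left_mono Linf_norm_le continuous_lp_low chi low norm_lp_low_le L A0 block) auto
  also have "\<dots> = ereal (4 * A / sqrt (dyadic L (int q)))"
    using pos[of q] by (simp add: field_simps)
  also have "\<dots> < ereal (c * \<nu>)" using small[of q] by simp
  finally show ?thesis
    unfolding determining_wavenumber_def using high by (intro Inf_lower) blast
qed

text \<open>Choose the least \<open>q\<close> whose dyadic number exceeds the threshold
  \<open>Y\<close>. If \<open>q = 0\<close>, the difference from \<open>dyadic L 0\<close> is zero;
  otherwise the preceding dyadic number is at most \<open>Y\<close>, so this one is at most
  \<open>2 * Y\<close>. The doubling turns 3600 into 7200.\<close>

lemma determining_wavenumber_gap: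
  assumes chi: "lp_cutoff chi" "\<And>\<xi>. chi \<xi> \<le> M" and r: "2 < r" "r < 3" and c: "0 < c"
    and L: "0 < L" and nu: "0 < \<nu>"
    and v: "in_L2 L v" "zero_mean L v" and G: "is_weak_grad L v G"
    and X: "(LINT x|torus L. (norm (G x))\<^sup>2) = X"
  shows "determining_wavenumber chi r c L \<nu> v - ereal (dyadic L 0) \<le> ereal (7200 * M\<^sup>2 / c\<^sup>2 * X / \<nu>\<^sup>2)"
proof -
  define Y where "Y = 3600 * M\<^sup>2 / c\<^sup>2 * X / \<nu>\<^sup>2"
  have "0 \<le> X" using X by (metis Bochner_Integration.integral_nonneg zero_le_power2)
  then have Y0: "0 \<le> Y" by (simp add: Y_def)
  obtain n where "Y * L < 2 ^ n" using real_arch_pow[of 2 "Y * L"] by auto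
  then have "Y < dyadic L (int n)" using L by (simp add: dyadic_nat field_simps)
  define q where "q = (LEAST q. Y < dyadic L (int q))"
  have q: "Y < dyadic L (int q)"
    unfolding q_def by (rule LeastI) fact
  have "dyadic L (int q) - dyadic L 0 \<le> 2 * Y"
  proof (cases q)
    case 0
    then show ?thesis using Y0 by simp
  next
    case (Suc p)
    then have "\<not> Y < dyadic L (int p)" unfolding q_def by (metis lessI not_less_Least)
    moreover have "dyadic L (int q) = 2 * dyadic L (int p)" by (simp only: Suc dyadic_nat power_Suc times_divide_eq_right)
    moreover have "0 < dyadic L 0" using L by (simp add: dyadic_def)
    ultimately show ?thesis by simp
  qed
  moreover have "determining_wavenumber chi r c L \<nu> v \<le> ereal (dyadic L (int q))"
    by (rule determining_wavenumber_le_dyadic[OF chi r c L nu v G X q[unfolded Y_def]])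
  then have "determining_wavenumber chi r c L \<nu> v - ereal (dyadic L 0)
      \<le> ereal (dyadic L (int q)) - ereal (dyadic L 0)"
    by (rule ereal_minus_mono) simp
  ultimately show ?thesis by (simp add: Y_def order_trans)
qed

text \<open>If a weak gradient exists, the chosen \<open>weak_grad\<close> is one and is square
  integrable, so the extended integral is an ordinary finite one.\<close>

lemma grad_norm_sq_cases:
  obtains "grad_norm_sq L v = \<infinity>"
  | G where "is_weak_grad L v G" "grad_norm_sq L v = ennreal (LINT x|torus L. (norm (G x))\<^sup>2)"
proof (cases "\<exists>G. is_weak_grad L v G")
  case True
  then have G: "is_weak_grad L v (weak_grad L v)" unfolding weak_grad_def by (rule someI_ex)
  then have "integrable (torus L) (\<lambda>x. (norm (weak_grad L v x))\<^sup>2)"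
    by (simp add: is_weak_grad_def in_L2_def)
  then have "grad_norm_sq L v = ennreal (LINT x|torus L. (norm (weak_grad L v x))\<^sup>2)"
    using True by (simp add: grad_norm_sq_def nn_integral_eq_integral)
  with G show thesis by (rule that(2))
qed (simp add: grad_norm_sq_def that(1))

theorem lemma4p2:
  fixes chi :: "real^3 \<Rightarrow> real" and r c :: real
  assumes "lp_cutoff chi" and "2 < r" and "r < 3" and "0 < c"
  shows "\<exists>C>0. \<forall>(L::real) (\<nu>::real) (f :: (real^3 \<Rightarrow> real^3) \<Rightarrow> real) (T::real) (u :: real \<Rightarrow> real^3 \<Rightarrow> real^3).
           0 < L \<longrightarrow> 0 < \<nu> \<longrightarrow> 0 < T \<longrightarrow>
           in_Hminus1 L f \<longrightarrow> zero_mean_force f \<longrightarrow>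
           weak_solution L \<nu> f T u \<longrightarrow> (\<forall>t\<in>{0..T}. zero_mean L (u t)) \<longrightarrow>
           (\<forall>t\<in>{0..T}.
              determining_wavenumber chi r c L \<nu> (u t) - ereal (dyadic L 0)
                \<le> ereal C * (enn2ereal (grad_norm_sq L (u t)) / ereal (\<nu>\<^sup>2)))"
proof -
  obtain M where M: "1 \<le> M" "\<And>\<xi>. chi \<xi> \<le> M" using lp_cutoff_bounded[OF assms(1)] by blast
  \<comment> \<open>\<open>M\<close> is obtained from \<open>chi\<close> before \<open>L\<close>,
    \<open>\<nu>\<close> and \<open>u\<close> are fixed, which makes the constant uniform in
    them.\<close>
  have C: "0 < 7200 * M\<^sup>2 / c\<^sup>2" using M(1) assms(4) by simp
  show ?thesis
  proof (intro exI[of _ "7200 * M\<^sup>2 / c\<^sup>2"] conjI C allI impI ballI)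
    fix L \<nu> :: real and f :: "(real^3 \<Rightarrow> real^3) \<Rightarrow> real" and T t :: real
      and u :: "real \<Rightarrow> real^3 \<Rightarrow> real^3"
    assume L: "0 < L" and nu: "0 < \<nu>" and u: "weak_solution L \<nu> f T u"
      and zm: "\<forall>t\<in>{0..T}. zero_mean L (u t)" and t: "t \<in> {0..T}"
    have v: "in_L2 L (u t)" "zero_mean L (u t)"
      using u zm t by (auto simp: weak_solution_def weakly_continuous_def)
    show "determining_wavenumber chi r c L \<nu> (u t) - ereal (dyadic L 0)
        \<le> ereal (7200 * M\<^sup>2 / c\<^sup>2) * (enn2ereal (grad_norm_sq L (u t)) / ereal (\<nu>\<^sup>2))"
    proof (cases rule: grad_norm_sq_cases[of L "u t"])
      \<comment> \<open>With an infinite gradient norm the right-hand side is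
        \<open>\<infinity>\<close>, since its other factors are positive and finite.\<close>
      case 1
      then show ?thesis using C nu assms(4) M(1) by simp
    next
      case (2 G)
      define X where "X = (LINT x|torus L. (norm (G x))\<^sup>2)"
      have "0 \<le> X" by (simp add: X_def)
      then have "enn2ereal (grad_norm_sq L (u t)) = ereal X" using 2(2) by (simp add: X_def enn2ereal_ennreal)
      then show ?thesis
        using determining_wavenumber_gap[OF assms(1) M(2) assms(2-4) L nu v 2(1) X_def[symmetric]] nu
        by simp
    qed
  qed
qed

end
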